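(* Let $\mathbb{X}$ be a finite dimensional real inner product space with induced norm $\|\cdot\|$, and let $\Phi:\mathbb{X}\to(-\infty,\infty]$ be a proper lower semicontinuous function that is coercive and bounded below. Let $m\ge 0$ be an integer, $a>0$, $b>0$, and let $\{x^k\}_{k\in\mathbb{N}}\subset\mathbb{X}$ be a sequence such that for each $k\in\mathbb{N}$: (H1) $\Phi(x^{k+1})+a\|x^{k+1}-x^k\|^2\le\max_{j=[k-m]_+,\ldots,k}\Phi(x^j)$; (H2) there exists $w^k\in\partial\Phi(x^k)$ such that $\|w^{k+1}\|\le b\|x^{k+1}-x^k\|$. Suppose that $\Phi$ is a KL function, that $$\liminf_{k\to\infty}\Phi(x^k)\ge\lim_{k\to\infty}\Phi(x^{\ell(k)}),$$ and that $\limsup_{j\to\infty}\Phi(x^{k_j})\le\Phi(\widehat{x})$ for each subsequence $\{x^{k_j}\}_{j\in\mathbb{N}}$ with $\lim_{j\to\infty}x^{k_j}=\widehat{x}$. Let $$K_1:=\Big\{k\in\mathbb{N}\ \big|\ \Phi(x^{\ell(k+1)})-\Phi(x^{k+1})\ge\tfrac{a}{2}\|x^{k+1}-x^k\|^2\Big\},$$ and suppose that $$\sum_{k\in K_1}\sqrt{\Phi(x^{\ell(k+1)})-\Phi(x^{k+1})}<\infty\quad\text{whenever}\quad\liminf_{K_1\ni k\to\infty}\frac{\Phi(x^{\ell(k)})-\Phi(x^{\ell(k+1)})}{\|x^{k+1}-x^k\|^2}=0 .$$ Then $\sum_{k=0}^\infty\|x^{k+1}-x^k\|<\infty$.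
   Context: $[t]_+:=\max(0,t)$. For each $k$, $\ell(k)$ denotes the largest index in $\arg\max_{j=[k-m]_+,\ldots,k}\Phi(x^j)$ (under (H1), $\{\Phi(x^{\ell(k)})\}$ is nonincreasing, so its limit exists). $\partial\Phi$ denotes the limiting (Mordukhovich) subdifferential; it is considered only at points of $\mathrm{dom}\,\Phi$. KL property: for $\eta\in(0,\infty]$, let $\Upsilon_\eta$ be the family of continuous concave $\varphi:[0,\eta)\to\mathbb{R}_+$ that are continuously differentiable on $(0,\eta)$ with $\varphi'>0$ there and $\varphi(0)=0$. A proper lsc $h$ has the KL property at $\overline{x}\in\mathrm{dom}\,\partial h$ if there exist $\eta\in(0,\infty]$, a neighborhood $\mathcal{U}$ of $\overline{x}$ and $\varphi\in\Upsilon_\eta$ such that $\varphi'(h(x)-h(\overline{x}))\,\mathrm{dist}(0,\partial h(x))\ge1$ for all $x\in\mathcal{U}$ with $h(\overline{x})<h(x)<h(\overline{x})+\eta$. $h$ is a KL function if it has the KL property at every point of $\mathrm{dom}\,\partial h$. Convention: the quotient with denominator $\|x^{k+1}-x^k\|^2$ is read as $+\infty$ when $x^{k+1}=x^k$, and a liminf over a finite index set is $+\infty$. *)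

theory Defs
  imports "HOL-Analysis.Analysis"
begin

definition proper :: "('a \<Rightarrow> ereal) \<Rightarrow> bool" where
  "proper h \<longleftrightarrow> (\<forall>z. h z \<noteq> -\<infinity>) \<and> (\<exists>z. h z \<noteq> \<infinity>)"

definition lower_semicont :: "('a::topological_space \<Rightarrow> ereal) \<Rightarrow> bool" where
  "lower_semicont h \<longleftrightarrow> (\<forall>z. h z \<le> Liminf (at z) h)"

definition coercive :: "('a::real_normed_vector \<Rightarrow> ereal) \<Rightarrow> bool" where
  "coercive h \<longleftrightarrow> (h \<longlongrightarrow> \<infinity>) at_infinity"

definition bounded_from_below :: "('a \<Rightarrow> ereal) \<Rightarrow> bool" where
  "bounded_from_below h \<longleftrightarrow> (\<exists>c::real. \<forall>z. ereal c \<le> h z)"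

text \<open>Both subdifferentials below are empty outside the effective domain.\<close>

definition frechet_subdiff :: "('a::real_inner \<Rightarrow> ereal) \<Rightarrow> 'a \<Rightarrow> 'a set" where
  "frechet_subdiff h z =
     {v. \<bar>h z\<bar> \<noteq> \<infinity> \<and>
         0 \<le> Liminf (at z) (\<lambda>y. (h y - h z - ereal (inner v (y - z))) / ereal (norm (y - z)))}"

definition limiting_subdiff :: "('a::real_inner \<Rightarrow> ereal) \<Rightarrow> 'a \<Rightarrow> 'a set" where
  "limiting_subdiff h z =
     {v. \<bar>h z\<bar> \<noteq> \<infinity> \<and>
         (\<exists>y u. (\<forall>n. u n \<in> frechet_subdiff h (y n)) \<and>
                y \<longlonglongrightarrow> z \<and> (\<lambda>n. h (y n)) \<longlonglongrightarrow> h z \<and> u \<longlonglongrightarrow> v)}"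

definition dom_limiting_subdiff :: "('a::real_inner \<Rightarrow> ereal) \<Rightarrow> 'a set" where
  "dom_limiting_subdiff h = {z. limiting_subdiff h z \<noteq> {}}"

text \<open>Extended-valued distance of the origin to a set. It is \<open>\<infinity>\<close> for the empty set, which the
  Kurdyka-Lojasiewicz inequality relies on; \<^const>\<open>infdist\<close> and \<^const>\<open>setdist\<close> return \<open>0\<close> there.\<close>

definition dist_origin :: "'a::real_normed_vector set \<Rightarrow> ereal" where
  "dist_origin S = (INF v\<in>S. ereal (norm v))"

text \<open>The desingularizing functions on \<open>[0, \<eta>)\<close>; values outside this interval are irrelevant.\<close>

definition desingularizing :: "ereal \<Rightarrow> (real \<Rightarrow> real) set" where
  "desingularizing \<eta> =
     {\<phi>. continuous_on {t. 0 \<le> t \<and> ereal t < \<eta>} \<phi> \<and>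
         concave_on {t. 0 \<le> t \<and> ereal t < \<eta>} \<phi> \<and>
         (\<forall>t. 0 \<le> t \<and> ereal t < \<eta> \<longrightarrow> 0 \<le> \<phi> t) \<and>
         (\<forall>t. 0 < t \<and> ereal t < \<eta> \<longrightarrow> \<phi> field_differentiable (at t) \<and> 0 < deriv \<phi> t) \<and>
         continuous_on {t. 0 < t \<and> ereal t < \<eta>} (deriv \<phi>) \<and>
         \<phi> 0 = 0}"

definition KL_property_at :: "('a::real_inner \<Rightarrow> ereal) \<Rightarrow> 'a \<Rightarrow> bool" where
  "KL_property_at h xbar \<longleftrightarrow>
     (\<exists>\<eta> U \<phi>. 0 < \<eta> \<and> open U \<and> xbar \<in> U \<and> \<phi> \<in> desingularizing \<eta> \<and>
        (\<forall>z\<in>U. h xbar < h z \<and> h z < h xbar + \<eta> \<longrightarrow>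
           1 \<le> ereal (deriv \<phi> (real_of_ereal (h z - h xbar))) * dist_origin (limiting_subdiff h z)))"

definition KL_function :: "('a::real_inner \<Rightarrow> ereal) \<Rightarrow> bool" where
  "KL_function h \<longleftrightarrow> (\<forall>xbar\<in>dom_limiting_subdiff h. KL_property_at h xbar)"

text \<open>The lower end \<open>k - m\<close> of the window is truncated subtraction, i.e. \<open>max 0 (k - m)\<close>.\<close>

definition window_max :: "('a \<Rightarrow> ereal) \<Rightarrow> (nat \<Rightarrow> 'a) \<Rightarrow> nat \<Rightarrow> nat \<Rightarrow> ereal" where
  "window_max \<Phi> x m k = Max ((\<lambda>j. \<Phi> (x j)) ` {k - m..k})"

definition ell :: "('a \<Rightarrow> ereal) \<Rightarrow> (nat \<Rightarrow> 'a) \<Rightarrow> nat \<Rightarrow> nat \<Rightarrow> nat" where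
  "ell \<Phi> x m k = Max {j \<in> {k - m..k}. \<Phi> (x j) = window_max \<Phi> x m k}"

definition K\<^sub>1 :: "('a::real_normed_vector \<Rightarrow> ereal) \<Rightarrow> (nat \<Rightarrow> 'a) \<Rightarrow> nat \<Rightarrow> real \<Rightarrow> nat set" where
  "K\<^sub>1 \<Phi> x m a =
     {k. ereal (a / 2 * (norm (x (Suc k) - x k))\<^sup>2)
           \<le> \<Phi> (x (ell \<Phi> x m (Suc k))) - \<Phi> (x (Suc k))}"

definition decrease_quotient :: "('a::real_normed_vector \<Rightarrow> ereal) \<Rightarrow> (nat \<Rightarrow> 'a) \<Rightarrow> nat \<Rightarrow> nat \<Rightarrow> ereal" where
  "decrease_quotient \<Phi> x m k =
     (if x (Suc k) = x k then \<infinity>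
      else (\<Phi> (x (ell \<Phi> x m k)) - \<Phi> (x (ell \<Phi> x m (Suc k)))) / ereal ((norm (x (Suc k) - x k))\<^sup>2))"

text \<open>Lower limit along an index set. For finite \<open>K\<close> the filter is \<^term>\<open>bot\<close>, so the value is \<open>\<infinity>\<close>.\<close>

definition liminf_along :: "nat set \<Rightarrow> (nat \<Rightarrow> ereal) \<Rightarrow> ereal" where
  "liminf_along K q = Liminf (inf sequentially (principal K)) q"

end

theory Submission
  imports Defs
begin

text \<open>Write \<open>M k\<close> for the window maximum, \<open>L\<close> for its limit and \<open>d k\<close> for the step lengths. For
  \<open>k\<close> outside \<open>K\<^sub>1\<close>, (H1) gives \<open>M k - M (k + 1) \<ge> (a / 2) (d k)\<^sup>2\<close>. If the lower limit of the
  quotients is positive, the same holds, with another constant, for all large \<open>k\<close> in \<open>K\<^sub>1\<close>;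
  if it vanishes, \<open>d\<close> is summable on \<open>K\<^sub>1\<close> by assumption. On the other hand, the KL inequality at the
  maximiser \<open>x (l k)\<close> of the window, concavity of \<open>\<phi>\<close> and (H2) give
  \<open>M k - M (k + 1) \<le> b d (l k - 1) \<Delta> k\<close> with a telescoping and hence summable \<open>\<Delta>\<close>. By
  AM-GM, \<open>d k \<le> \<epsilon> d (l k - 1) + C \<Delta> k\<close> for any \<open>\<epsilon> > 0\<close>. Each index occurs as \<open>l k - 1\<close> for at most
  \<open>m + 1\<close> values of \<open>k\<close>, so \<open>\<epsilon> = 1 / (2 (m + 1))\<close> lets the first term be absorbed.\<close>

text \<open>Diagonal argument: each \<open>w n\<close> is itself a limit of Frechet subgradients, so
  one of them can be picked with point, subgradient and function value all within
  \<open>1 / (n + 1)\<close>. The picked sequences inherit the limits.\<close>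

lemma limiting_subdiff_closed:
  fixes h :: "'a::real_inner \<Rightarrow> ereal"
  assumes w: "\<And>n. w n \<in> limiting_subdiff h (z n)"
    and z: "z \<longlonglongrightarrow> z0" and wv: "w \<longlonglongrightarrow> v"
    and hz: "(\<lambda>n. h (z n)) \<longlonglongrightarrow> h z0" and fin: "\<bar>h z0\<bar> \<noteq> \<infinity>"
  shows "v \<in> limiting_subdiff h z0"
proof -
  \<comment> \<open>Values are compared as reals; \<open>h\<close> is finite at \<open>z0\<close>,
    at every \<open>z n\<close>, and wherever a Frechet subgradient exists.\<close>
  let ?f = "\<lambda>y. real_of_ereal (h y)"
  have "\<exists>y u. u \<in> frechet_subdiff h y \<and> dist y (z n) < inverse (real (Suc n)) \<and>
          dist u (w n) < inverse (real (Suc n)) \<and> dist (?f y) (?f (z n)) < inverse (real (Suc n))" for n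
  proof -
    have fin_n: "\<bar>h (z n)\<bar> \<noteq> \<infinity>" using w[of n] by (simp add: limiting_subdiff_def)
    obtain y u where fr: "\<forall>k. u k \<in> frechet_subdiff h (y k)" and y: "y \<longlonglongrightarrow> z n"
      and hy: "(\<lambda>k. h (y k)) \<longlonglongrightarrow> h (z n)" and u: "u \<longlonglongrightarrow> w n"
      using w[of n] unfolding limiting_subdiff_def mem_Collect_eq by (elim conjE exE)
    have "(\<lambda>k. ?f (y k)) \<longlonglongrightarrow> ?f (z n)"
      using hy fin_n by (intro lim_real_of_ereal) (simp add: ereal_real')
    moreover have "0 < inverse (real (Suc n))" by simp
    ultimately have "\<forall>\<^sub>F k in sequentially. dist (y k) (z n) < inverse (real (Suc n)) \<and>
        dist (u k) (w n) < inverse (real (Suc n)) \<and> dist (?f (y k)) (?f (z n)) < inverse (real (Suc n))"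
      using y u by (intro eventually_conj tendstoD)
    then show ?thesis
      using fr eventually_happens'[OF sequentially_bot] by blast
  qed
  then obtain y u where fr: "\<And>n. u n \<in> frechet_subdiff h (y n)"
    and d: "\<And>n. dist (y n) (z n) < inverse (real (Suc n))" 
      "\<And>n. dist (u n) (w n) < inverse (real (Suc n))" 
      "\<And>n. dist (?f (y n)) (?f (z n)) < inverse (real (Suc n))"
    by metis
  have transfer: "p \<longlonglongrightarrow> l"
    if "\<And>n. dist (p n) (q n) < inverse (real (Suc n))" and "q \<longlonglongrightarrow> l"
    for p q :: "nat \<Rightarrow> 'b::metric_space" and l
  proof -
    have "(\<lambda>n. dist (p n) (q n)) \<longlonglongrightarrow> 0"
      by (rule tendsto_sandwich[OF _ _ tendsto_const LIMSEQ_inverse_real_of_nat])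
        (auto intro!: always_eventually less_imp_le that(1) simp del: of_nat_Suc)
    then have "(\<lambda>n. dist (p n) (q n) + dist (q n) l) \<longlonglongrightarrow> 0 + dist l l"
      using that(2) by (intro tendsto_intros)
    then have "(\<lambda>n. dist (p n) (q n) + dist (q n) l) \<longlonglongrightarrow> 0" by simp
    then have "(\<lambda>n. dist (p n) l) \<longlonglongrightarrow> 0"
      by (rule tendsto_sandwich[OF _ _ tendsto_const, rotated 2])
        (simp_all add: dist_triangle)
    then show ?thesis by (simp add: tendsto_dist_iff[symmetric])
  qed
  have "(\<lambda>n. ?f (z n)) \<longlonglongrightarrow> ?f z0"
    using hz fin by (intro lim_real_of_ereal) (simp add: ereal_real')
  then have "(\<lambda>n. ?f (y n)) \<longlonglongrightarrow> ?f z0" using d(3) by (rule transfer[rotated])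
  then have "(\<lambda>n. ereal (?f (y n))) \<longlonglongrightarrow> ereal (?f z0)" by simp
  moreover have "ereal (?f (y n)) = h (y n)" for n
    using fr[of n] by (simp add: frechet_subdiff_def ereal_real')
  ultimately have "(\<lambda>n. h (y n)) \<longlonglongrightarrow> h z0"
    using fin by (simp add: ereal_real')
  then show ?thesis
    unfolding limiting_subdiff_def using fr fin transfer[OF d(1) z] transfer[OF d(2) wv] by blast
qed

lemma desingularizing_tangent:
  assumes \<phi>: "\<phi> \<in> desingularizing \<eta>" and "0 \<le> s" "0 < t" "ereal s < \<eta>" "ereal t < \<eta>"
  shows "deriv \<phi> t * (t - s) \<le> \<phi> t - \<phi> s"
proof -
  let ?S = "{t. 0 \<le> t \<and> ereal t < \<eta>}"
  have "convex_on ?S (\<lambda>t. - \<phi> t)"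
    using \<phi> by (simp add: desingularizing_def concave_on_def)
  moreover have "connected ?S"
    using convex_on_imp_convex[OF calculation] by (rule convex_connected)
  moreover have "t \<in> interior ?S"
  proof (rule interiorI)
    have "open (ereal -` {..<\<eta>})" by (intro open_ereal_vimage open_lessThan)
    then show "open ({0<..} \<inter> ereal -` {..<\<eta>})" by (intro open_Int) auto
  qed (use assms in auto)
  moreover have "((\<lambda>t. - \<phi> t) has_real_derivative - deriv \<phi> t) (at t within ?S)"
    using \<phi> assms
    by (intro DERIV_minus DERIV_subset[OF DERIV_deriv_iff_field_differentiable[THEN iffD2]])
      (auto simp: desingularizing_def)
  ultimately have "- \<phi> s - - \<phi> t \<ge> - deriv \<phi> t * (s - t)"
    using assms by (intro convex_on_imp_above_tangent) auto
  then show ?thesis by (simp add: algebra_simps)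
qed

text \<open>Recursive choice: every neighbourhood of \<open>z\<close> is visited arbitrarily late,
  so each new index can exceed the previous one while the tolerance shrinks.\<close>

lemma subseq_of_frequently:
  fixes x :: "nat \<Rightarrow> 'a::metric_space"
  assumes "\<And>V. open V \<Longrightarrow> z \<in> V \<Longrightarrow> \<exists>\<^sub>F k in sequentially. x k \<in> V"
  obtains r where "strict_mono r" "(x \<circ> r) \<longlonglongrightarrow> z"
proof -
  have "\<exists>k>n. dist (x k) z < inverse (real (Suc i))" for n i
    using assms[of "ball z (inverse (real (Suc i)))"]
    unfolding frequently_sequentially by (auto simp: dist_commute) (meson Suc_le_lessD)
  then obtain g where g: "\<And>n i. g n i > n" "\<And>n i. dist (x (g n i)) z < inverse (real (Suc i))"
    by metis
  define r where "r = rec_nat (g 0 0) (\<lambda>i n. g n (Suc i))"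
  have rS: "r (Suc i) = g (r i) (Suc i)" "r 0 = g 0 0" for i by (simp_all add: r_def)
  have "strict_mono r" by (simp add: strict_mono_Suc_iff rS g)
  moreover have "dist (x (r i)) z < inverse (real (Suc i))" for i
    by (cases i) (use g in \<open>simp_all add: rS del: of_nat_Suc\<close>)
  then have "(\<lambda>i. dist (x (r i)) z) \<longlonglongrightarrow> 0"
    by (intro tendsto_sandwich[OF _ _ tendsto_const LIMSEQ_inverse_real_of_nat])
      (auto intro!: always_eventually less_imp_le)
  then have "(x \<circ> r) \<longlonglongrightarrow> z" by (simp add: o_def tendsto_dist_iff[symmetric])
  ultimately show thesis by (rule that)
qed

text \<open>A uniform KL inequality by compactness of the closure of the range. The finitely many
  pairs are not merged into a single desingularizing function; for each late \<open>k\<close> some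
  pair in \<open>F\<close> applies.\<close>

lemma KL_along_bounded_sequence:
  fixes x :: "nat \<Rightarrow> 'a::euclidean_space"
  assumes KL: "KL_function h" and bdd: "bounded (range x)"
    and cluster: "\<And>r z. strict_mono r \<Longrightarrow> (x \<circ> r) \<longlonglongrightarrow> z \<Longrightarrow> z \<in> dom_limiting_subdiff h \<and> h z = l"
  obtains F where "finite F" "\<And>\<eta> \<phi>. (\<eta>, \<phi>) \<in> F \<Longrightarrow> 0 < \<eta> \<and> \<phi> \<in> desingularizing \<eta>"
    "\<forall>\<^sub>F k in sequentially. \<exists>(\<eta>, \<phi>)\<in>F. l < h (x k) \<and> h (x k) < l + \<eta> \<longrightarrow>
       1 \<le> ereal (deriv \<phi> (real_of_ereal (h (x k) - l))) * dist_origin (limiting_subdiff h (x k))"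
proof -
  let ?P = "\<lambda>k (\<eta>, \<phi>). l < h (x k) \<and> h (x k) < l + \<eta> \<longrightarrow>
       1 \<le> ereal (deriv \<phi> (real_of_ereal (h (x k) - l))) * dist_origin (limiting_subdiff h (x k))"
  let ?D = "{(\<eta>, \<phi>). 0 < \<eta> \<and> \<phi> \<in> desingularizing \<eta>}"
  define C where "C = closure (range x)"
  have "compact C" using bdd by (simp add: C_def compact_closure)
  define Q where "Q z V F \<longleftrightarrow> open V \<and> z \<in> V \<and> finite F \<and> F \<subseteq> ?D \<and>
      (\<forall>\<^sub>F k in sequentially. x k \<in> V \<longrightarrow> (\<exists>p\<in>F. ?P k p))" for z V F
  have "\<exists>V F. Q z V F" for z
  \<comment> \<open>Either the tail avoids some neighbourhood of \<open>z\<close>, and the empty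
    family serves vacuously, or \<open>z\<close> is a cluster point, and the KL property at
    \<open>z\<close> supplies a single pair.\<close>
  proof (cases "\<exists>V. open V \<and> z \<in> V \<and> \<not> (\<exists>\<^sub>F k in sequentially. x k \<in> V)")
    case True
    then obtain V where "open V" "z \<in> V" "\<forall>\<^sub>F k in sequentially. x k \<notin> V"
      by (auto simp: not_frequently)
    then show ?thesis unfolding Q_def
      by (intro exI[of _ V] exI[of _ "{}"]) (auto elim: eventually_mono)
  next
    case False
    then obtain r where "strict_mono r" "(x \<circ> r) \<longlonglongrightarrow> z" using subseq_of_frequently[of z x] by metis
    then have z: "z \<in> dom_limiting_subdiff h" "h z = l" using cluster by auto
    then obtain \<eta> U \<phi> where "0 < \<eta>" "open U" "z \<in> U" "\<phi> \<in> desingularizing \<eta>"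
      and "\<forall>y\<in>U. l < h y \<and> h y < l + \<eta> \<longrightarrow>
           1 \<le> ereal (deriv \<phi> (real_of_ereal (h y - l))) * dist_origin (limiting_subdiff h y)"
      using KL unfolding KL_function_def KL_property_at_def by blast
    then show ?thesis unfolding Q_def
      by (intro exI[of _ U] exI[of _ "{(\<eta>, \<phi>)}"]) auto
  qed
  then obtain V F where "\<And>z. Q z (V z) (F z)" by metis
  then have V: "\<And>z. open (V z)" "\<And>z. z \<in> V z"
    and F: "\<And>z. finite (F z)" "\<And>z. F z \<subseteq> ?D"
    and ev: "\<And>z. \<forall>\<^sub>F k in sequentially. x k \<in> V z \<longrightarrow> (\<exists>p\<in>F z. ?P k p)"
    unfolding Q_def by blast+
  obtain D where D: "D \<subseteq> C" "finite D" "C \<subseteq> (\<Union>z\<in>D. V z)"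
  proof (rule compactE_image[OF \<open>compact C\<close>, of C V])
    show "C \<subseteq> (\<Union>z\<in>C. V z)" using V(2) by auto
  qed (use V(1) in auto)
  have "\<forall>\<^sub>F k in sequentially. \<forall>z\<in>D. x k \<in> V z \<longrightarrow> (\<exists>p\<in>F z. ?P k p)"
    using D ev by (intro eventually_ball_finite) auto
  then have "\<forall>\<^sub>F k in sequentially. \<exists>p\<in>(\<Union>z\<in>D. F z). ?P k p"
  proof eventually_elim
    case (elim k)
    have "x k \<in> C" using closure_subset[of "range x"] by (auto simp: C_def)
    then show ?case using D(3) elim by (metis (no_types, lifting) UN_E UN_I subsetD)
  qed
  moreover have "finite (\<Union>z\<in>D. F z)" using D F by auto
  ultimately show thesis
    using F(2) by (intro that[of "\<Union>z\<in>D. F z"]) auto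
qed

text \<open>Summing the recursion over \<open>{N..<n}\<close> bounds each of the \<open>p\<close>
  shifted sums by the full partial sum, which \<open>\<epsilon> * real p < 1\<close> allows to be
  absorbed on the left.\<close>

lemma summable_of_contractive_recursion:
  fixes d e :: "nat \<Rightarrow> real"
  assumes d: "\<And>k. 0 \<le> d k" and e: "summable e" and \<epsilon>: "0 \<le> \<epsilon>" "\<epsilon> * real p < 1"
    and rec: "\<forall>\<^sub>F k in sequentially. d k \<le> \<epsilon> * (\<Sum>i=1..p. d (k - i)) + e k"
  shows "summable d"
proof -
  obtain N where N: "\<And>k. k \<ge> N \<Longrightarrow> k \<ge> p \<and> d k \<le> \<epsilon> * (\<Sum>i=1..p. d (k - i)) + e k"
    using eventually_conj[OF eventually_ge_at_top[of p] rec] unfolding eventually_sequentially by blast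
  obtain B where B: "\<And>n. \<bar>\<Sum>k<n. e k\<bar> \<le> B"
    using e by (metis summable_iff_convergent convergent_imp_Bseq Bseq_def real_norm_def)
  \<comment> \<open>The head of \<open>d\<close> before \<open>N\<close>, plus the block of
    \<open>e\<close> over \<open>{N..<n}\<close>, which is a difference of two partial sums of size
    at most \<open>B\<close>.\<close>
  define T where "T = (\<Sum>k<N. d k) + 2 * B"
  have "(1 - \<epsilon> * real p) * (\<Sum>k<n. d k) \<le> T" if "n \<ge> N" for n
  proof -
    have shift: "(\<Sum>k=N..<n. d (k - i)) \<le> (\<Sum>k<n. d k)" if "i \<in> {1..p}" for i
    proof -
      \<comment> \<open>From \<open>N\<close> on \<open>k \<ge> p \<ge> i\<close>, so
        \<open>k - i\<close> is not truncated.\<close>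
      have "inj_on (\<lambda>k. k - i) {N..<n}"
        using that N by (intro inj_onI) (metis atLeastAtMost_iff atLeastLessThan_iff eq_diff_iff le_trans)
      then have "(\<Sum>k=N..<n. d (k - i)) = (\<Sum>k\<in>(\<lambda>k. k - i) ` {N..<n}. d k)"
        by (simp add: sum.reindex)
      also have "\<dots> \<le> (\<Sum>k<n. d k)" using d by (intro sum_mono2) auto
      finally show ?thesis .
    qed
    have split: "(\<Sum>k<n. g k) = (\<Sum>k<N. g k) + (\<Sum>k=N..<n. g k)" for g :: "nat \<Rightarrow> real"
      using \<open>n \<ge> N\<close> by (metis atLeast0LessThan le0 sum.atLeastLessThan_concat)
    have "(\<Sum>k=N..<n. d k) \<le> (\<Sum>k=N..<n. \<epsilon> * (\<Sum>i=1..p. d (k - i)) + e k)"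
      using N by (intro sum_mono) auto
    also have "\<dots> = \<epsilon> * (\<Sum>i=1..p. \<Sum>k=N..<n. d (k - i)) + (\<Sum>k=N..<n. e k)"
      by (subst sum.swap) (simp add: sum.distrib sum_distrib_left)
    also have "\<dots> \<le> \<epsilon> * (real p * (\<Sum>k<n. d k)) + 2 * B"
    proof (rule add_mono)
      have "(\<Sum>i=1..p. \<Sum>k=N..<n. d (k - i)) \<le> (\<Sum>i=1..p. \<Sum>k<n. d k)"
        by (intro sum_mono shift)
      then show "\<epsilon> * (\<Sum>i=1..p. \<Sum>k=N..<n. d (k - i)) \<le> \<epsilon> * (real p * (\<Sum>k<n. d k))"
        using \<epsilon> by (intro mult_left_mono) auto
      show "(\<Sum>k=N..<n. e k) \<le> 2 * B" using split[of e] B[of n] B[of N] by linarith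
    qed
    finally show ?thesis using split[of d] by (simp add: T_def algebra_simps)
  qed
  then have "(\<Sum>k<n. d k) \<le> T / (1 - \<epsilon> * real p)" if "n \<ge> N" for n
    using that \<epsilon> by (simp add: pos_le_divide_eq mult.commute)
  moreover have "(\<Sum>k<n. d k) \<le> (\<Sum>k<max n N. d k)" for n
    using d by (intro sum_mono2) auto
  ultimately have "(\<Sum>k<n. d k) \<le> T / (1 - \<epsilon> * real p)" for n
    by (meson max.cobounded2 order_trans)
  then show ?thesis using d by (intro summableI_nonneg_bounded) auto
qed

lemma window_max_ell:
  shows "ell \<Phi> x m k \<in> {k - m..k}" and "\<Phi> (x (ell \<Phi> x m k)) = window_max \<Phi> x m k"
proof -
  let ?J = "{j \<in> {k - m..k}. \<Phi> (x j) = window_max \<Phi> x m k}"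
  have "window_max \<Phi> x m k \<in> (\<lambda>j. \<Phi> (x j)) ` {k - m..k}"
    unfolding window_max_def by (rule Max_in) auto
  then have "?J \<noteq> {}" by auto
  then have "Max ?J \<in> ?J" by (intro Max_in) auto
  then show "ell \<Phi> x m k \<in> {k - m..k}" and "\<Phi> (x (ell \<Phi> x m k)) = window_max \<Phi> x m k"
    by (auto simp: ell_def)
qed

lemma le_window_max: "j \<in> {k - m..k} \<Longrightarrow> \<Phi> (x j) \<le> window_max \<Phi> x m k"
  unfolding window_max_def by (rule Max_ge) auto

text \<open>The new window adds only the index \<open>Suc k\<close>, whose value is bounded by
  assumption; its other indices lie in the old window.\<close>

lemma window_max_antimono:
  assumes "\<And>k. \<Phi> (x (Suc k)) \<le> window_max \<Phi> x m k"
  shows "window_max \<Phi> x m (Suc k) \<le> window_max \<Phi> x m k"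
proof -
  have "\<Phi> (x j) \<le> window_max \<Phi> x m k" if "j \<in> {Suc k - m..Suc k}" for j
    using that assms le_window_max[of j k m \<Phi> x] by (cases "j = Suc k") auto
  then show ?thesis unfolding window_max_def[of \<Phi> x m "Suc k"] by (subst Max_le_iff) auto
qed

text \<open>The subgradient \<open>v\<close> bounds the distance by \<open>B\<close>, so the KL
  inequality reads \<open>1 \<le> B * deriv \<phi> t\<close>. Multiplying by \<open>t - s\<close>
  and applying the tangent inequality turns a decrease in value into a decrease of
  \<open>\<phi>\<close>.\<close>

lemma KL_decrease:
  fixes S :: "'a::real_normed_vector set"
  assumes \<phi>: "\<phi> \<in> desingularizing \<eta>" and st: "0 \<le> s" "s \<le> t" "0 < t" "ereal t < \<eta>"
    and KL: "1 \<le> ereal (deriv \<phi> t) * dist_origin S" and v: "v \<in> S" "norm v \<le> B"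
  shows "t - s \<le> B * (\<phi> t - \<phi> s)"
proof -
  have pos: "0 < deriv \<phi> t" using \<phi> st by (auto simp: desingularizing_def)
  have "dist_origin S \<le> ereal B"
    unfolding dist_origin_def by (rule INF_lower2[OF v(1)]) (use v in auto)
  then have "ereal (deriv \<phi> t) * dist_origin S \<le> ereal (deriv \<phi> t) * ereal B"
    using pos by (intro ereal_mult_left_mono) auto
  with KL have "1 \<le> ereal (deriv \<phi> t) * ereal B" by (rule order_trans)
  then have B: "1 \<le> B * deriv \<phi> t" by (simp add: mult.commute)
  have "0 \<le> B" using v(2) norm_ge_zero[of v] by linarith
  have "ereal s < \<eta>" using st by (metis ereal_less_eq(3) order_le_less_trans)
  then have tan: "deriv \<phi> t * (t - s) \<le> \<phi> t - \<phi> s"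
    using desingularizing_tangent[OF \<phi>] st by blast
  have "t - s \<le> (B * deriv \<phi> t) * (t - s)" using B st mult_right_mono[of 1 "B * deriv \<phi> t" "t - s"] by simp
  also have "\<dots> = B * (deriv \<phi> t * (t - s))" by simp
  also have "\<dots> \<le> B * (\<phi> t - \<phi> s)" using tan \<open>0 \<le> B\<close> by (rule mult_left_mono)
  finally show ?thesis .
qed

lemma desingularizing_mono:
  assumes \<phi>: "\<phi> \<in> desingularizing \<eta>" and "0 \<le> s" "s \<le> t" "ereal t < \<eta>"
  shows "\<phi> s \<le> \<phi> t"
proof (cases "s = t")
  case False
  then have t: "0 < t" using assms by linarith
  have "ereal s < \<eta>" using assms by (metis ereal_less_eq(3) order_le_less_trans)
  then have "deriv \<phi> t * (t - s) \<le> \<phi> t - \<phi> s"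
    using desingularizing_tangent[OF \<phi>] assms t by blast
  moreover have "0 \<le> deriv \<phi> t * (t - s)"
    using \<phi> assms t by (intro mult_nonneg_nonneg) (auto simp: desingularizing_def less_imp_le)
  ultimately show ?thesis by linarith
qed simp

text \<open>Weighted AM-GM in the form
  \<open>4 * (\<epsilon> * v) * r \<le> (\<epsilon> * v + r)^2\<close>, where \<open>r\<close> is
  chosen so that the left side equals \<open>b * v * q / c\<close>.\<close>

lemma square_le_product_imp:
  fixes u v q c b \<epsilon> :: real
  assumes "c * u\<^sup>2 \<le> b * v * q" "0 \<le> v" "0 \<le> q" "0 < c" "0 \<le> b" "0 < \<epsilon>"
  shows "u \<le> \<epsilon> * v + b / (4 * c * \<epsilon>) * q"
proof (rule power2_le_imp_le)
  define r where "r = b / (4 * c * \<epsilon>) * q"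
  have "c * u\<^sup>2 \<le> c * (4 * (\<epsilon> * v) * r)" using assms by (simp add: r_def field_simps)
  then have "u\<^sup>2 \<le> 4 * (\<epsilon> * v) * r" using \<open>0 < c\<close> by simp
  also have "\<dots> \<le> (\<epsilon> * v + r)\<^sup>2"
    using sum_squares_ge_zero[of "\<epsilon> * v - r" 0] by (simp add: power2_eq_square algebra_simps)
  finally show "u\<^sup>2 \<le> (\<epsilon> * v + b / (4 * c * \<epsilon>) * q)\<^sup>2" by (simp add: r_def)
qed (use assms in auto)

theorem theorem3p4:
  fixes \<Phi> :: "'a::euclidean_space \<Rightarrow> ereal"
    and x :: "nat \<Rightarrow> 'a"
    and m :: nat
    and a b :: real
  assumes "proper \<Phi>" and "lower_semicont \<Phi>" and "coercive \<Phi>" and "bounded_from_below \<Phi>"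
    and "a > 0" and "b > 0"
    and H1: "\<And>k. \<Phi> (x (Suc k)) + ereal (a * (norm (x (Suc k) - x k))\<^sup>2) \<le> window_max \<Phi> x m k"
    and H2: "\<exists>w. \<forall>k. w k \<in> limiting_subdiff \<Phi> (x k) \<and>
               norm (w (Suc k)) \<le> b * norm (x (Suc k) - x k)"
    and KL: "KL_function \<Phi>"
    and lim_le_liminf: "liminf (\<lambda>k. \<Phi> (x k)) \<ge> lim (\<lambda>k. \<Phi> (x (ell \<Phi> x m k)))"
    and limsup_le: "\<And>r xhat. strict_mono r \<Longrightarrow> (\<lambda>j. x (r j)) \<longlonglongrightarrow> xhat \<Longrightarrow>
               limsup (\<lambda>j. \<Phi> (x (r j))) \<le> \<Phi> xhat"
    and K1_sum: "liminf_along (K\<^sub>1 \<Phi> x m a) (decrease_quotient \<Phi> x m) = 0 \<Longrightarrow>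
               (\<lambda>k. sqrt (real_of_ereal (\<Phi> (x (ell \<Phi> x m (Suc k))) - \<Phi> (x (Suc k)))))
                 summable_on K\<^sub>1 \<Phi> x m a"
  shows "summable (\<lambda>k. norm (x (Suc k) - x k))"
proof -

  \<comment> \<open>Finiteness along the sequence and monotone window maxima\<close>
  obtain w where w: "\<And>k. w k \<in> limiting_subdiff \<Phi> (x k)"
    and w_le: "\<And>k. norm (w (Suc k)) \<le> b * norm (x (Suc k) - x k)"
    using H2 by blast
  define f where "f k = real_of_ereal (\<Phi> (x k))" for k
  define l where "l = ell \<Phi> x m"
  define M where "M k = f (l k)" for k
  define d where "d k = norm (x (Suc k) - x k)" for k
  \<comment> \<open>A point with a limiting subgradient lies in the effective domain, so all values
    along the sequence are real.\<close>
  have \<Phi>x: "\<Phi> (x k) = ereal (f k)" for k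
    using w[of k] by (simp add: f_def limiting_subdiff_def ereal_real')
  have l: "l k \<in> {k - m..k}" for k unfolding l_def by (rule window_max_ell)
  have W: "window_max \<Phi> x m k = ereal (M k)" for k
    using window_max_ell(2)[of \<Phi> x m k] by (simp add: M_def l_def \<Phi>x)
  have d0: "0 \<le> d k" for k by (simp add: d_def)
  have descent: "f (Suc k) + a * (d k)\<^sup>2 \<le> M k" for k
    using H1[of k] by (simp add: W \<Phi>x d_def)
  have "\<Phi> (x (Suc k)) \<le> window_max \<Phi> x m k" for k
    using descent[of k] \<open>a > 0\<close> by (simp add: W \<Phi>x) (smt (verit) mult_nonneg_nonneg zero_le_power2)
  from window_max_antimono[of \<Phi> x m, OF this] have anti: "M (Suc k) \<le> M k" for k
    by (simp add: W)
  then have "decseq M" by (simp add: decseq_Suc_iff)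
  have fM: "f k \<le> M k" for k using le_window_max[of k k m \<Phi> x] by (simp add: W \<Phi>x)

  \<comment> \<open>Convergence of the values and of the steps\<close>
  obtain c0 where "\<And>z. ereal c0 \<le> \<Phi> z"
    using \<open>bounded_from_below \<Phi>\<close> unfolding bounded_from_below_def by blast
  then have "c0 \<le> M k" for k using \<Phi>x[of "l k"] by (metis M_def ereal_less_eq(3))
  then obtain L where M_lim: "M \<longlonglongrightarrow> L" and L_le: "\<And>k. L \<le> M k"
    using decseq_convergent[OF \<open>decseq M\<close>, of c0] by blast
  \<comment> \<open>\<open>lim\<close> is meaningful only for convergent sequences; here it is
    identified with \<open>L\<close>.\<close>
  have "lim (\<lambda>k. \<Phi> (x (ell \<Phi> x m k))) = ereal L"
    using M_lim by (intro limI) (simp add: \<Phi>x M_def[abs_def] l_def)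
  then have liminf: "ereal L \<le> liminf (\<lambda>k. ereal (f k))" using lim_le_liminf by (simp add: \<Phi>x)
  \<comment> \<open>Squeeze: the lower bound is the hypothesis on the lower limit, the upper one is
    \<open>f k \<le> M k\<close>.\<close>
  have fL: "f \<longlonglongrightarrow> L"
  proof (rule order_tendstoI)
    fix y assume "y < L"
    then show "\<forall>\<^sub>F k in sequentially. y < f k"
      using liminf[unfolded le_Liminf_iff, rule_format, of "ereal y"] by simp
  next
    fix y assume "L < y"
    then have "\<forall>\<^sub>F k in sequentially. M k < y" using order_tendstoD(2)[OF M_lim] by blast
    then show "\<forall>\<^sub>F k in sequentially. f k < y"
      by (rule eventually_mono) (use fM in \<open>auto intro: le_less_trans\<close>)
  qed
  \<comment> \<open>By (H1), \<open>a * (d k)^2\<close> is at most \<open>M k - f (Suc k)\<close>,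
    and both terms of this difference tend to \<open>L\<close>.\<close>
  have dL: "d \<longlonglongrightarrow> 0"
  proof -
    have "(\<lambda>k. (M k - f (Suc k)) / a) \<longlonglongrightarrow> (L - L) / a"
      using \<open>a > 0\<close> by (intro tendsto_intros M_lim LIMSEQ_Suc[OF fL]) simp
    then have "(\<lambda>k. (M k - f (Suc k)) / a) \<longlonglongrightarrow> 0" by simp
    then have "(\<lambda>k. (d k)\<^sup>2) \<longlonglongrightarrow> 0"
    proof (rule tendsto_sandwich[OF _ _ tendsto_const, rotated 2])
      show "\<forall>\<^sub>F k in sequentially. (d k)\<^sup>2 \<le> (M k - f (Suc k)) / a"
        using descent \<open>a > 0\<close> by (intro always_eventually) (simp add: pos_le_divide_eq le_diff_eq algebra_simps)
    qed simp
    then show ?thesis using tendsto_real_sqrt[of "\<lambda>k. (d k)\<^sup>2" 0] d0 by simp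
  qed

  \<comment> \<open>Boundedness and cluster points\<close>
  have bdd: "bounded (range x)"
  proof -
    \<comment> \<open>The sequence stays in the sublevel set of level \<open>M 0\<close>, which
      coercivity makes bounded.\<close>
    have "\<forall>\<^sub>F z in at_infinity. ereal (M 0) < \<Phi> z"
      using \<open>coercive \<Phi>\<close> unfolding coercive_def by (intro order_tendstoD(1)) auto
    then obtain B where B: "\<And>z. B \<le> norm z \<Longrightarrow> ereal (M 0) < \<Phi> z"
      unfolding eventually_at_infinity by blast
    have "f k \<le> M 0" for k using fM[of k] decseqD[OF \<open>decseq M\<close>, of 0 k] by simp
    then have "norm (x k) \<le> B" for k
      using B[of "x k"] by (metis \<Phi>x ereal_less_eq(3) leD linorder_le_cases)
    then show ?thesis by (auto intro: boundedI)
  qed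
  have w0: "w \<longlonglongrightarrow> 0"
  proof -
    have "(\<lambda>k. b * d k) \<longlonglongrightarrow> b * 0" by (intro tendsto_intros dL)
    then have "(\<lambda>k. b * d k) \<longlonglongrightarrow> 0" by simp
    then have "(\<lambda>k. w (Suc k)) \<longlonglongrightarrow> 0"
      by (rule Lim_null_comparison[rotated]) (simp add: w_le d_def)
    then show ?thesis by (rule LIMSEQ_imp_Suc)
  qed
  \<comment> \<open>The limsup hypothesis gives \<open>L \<le> \<Phi> z\<close> and lower
    semicontinuity the converse. With values converging and \<open>w\<close> tending to
    \<open>0\<close>, closedness puts \<open>0\<close> into the limiting subdifferential at
    \<open>z\<close>.\<close>
  have cluster: "z \<in> dom_limiting_subdiff \<Phi> \<and> \<Phi> z = ereal L"
    if r: "strict_mono r" and z: "(x \<circ> r) \<longlonglongrightarrow> z" for r z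
  proof -
    have "(f \<circ> r) \<longlonglongrightarrow> L" by (rule LIMSEQ_subseq_LIMSEQ[OF fL r])
    then have fr: "(\<lambda>j. \<Phi> (x (r j))) \<longlonglongrightarrow> ereal L" by (simp add: \<Phi>x o_def)
    have "limsup (\<lambda>j. \<Phi> (x (r j))) = ereal L" using fr by (intro lim_imp_Limsup) auto
    then have "ereal L \<le> \<Phi> z" using limsup_le[OF r] z by (simp add: o_def)
    moreover have "\<not> ereal L < \<Phi> z"
    proof
      assume "ereal L < \<Phi> z"
      then obtain c where c: "ereal L < c" "c < \<Phi> z" using dense by blast
      have "\<Phi> z \<le> Liminf (at z) \<Phi>"
        using \<open>lower_semicont \<Phi>\<close> by (simp add: lower_semicont_def)
      then have "\<forall>\<^sub>F y in at z. c < \<Phi> y" using c by (auto simp: le_Liminf_iff)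
      \<comment> \<open>The point \<open>z\<close> itself is added to the punctured neighbourhood,
        since the subsequence may hit it.\<close>
      then have "\<forall>\<^sub>F y in nhds z. c < \<Phi> y"
        unfolding eventually_at_filter by (rule eventually_mono) (use c in auto)
      then have "\<forall>\<^sub>F j in sequentially. c < \<Phi> ((x \<circ> r) j)"
        using z by (rule eventually_compose_filterlim)
      moreover have "\<forall>\<^sub>F j in sequentially. \<Phi> (x (r j)) < c"
        using order_tendstoD(2)[OF fr c(1)] .
      ultimately have "\<forall>\<^sub>F j::nat in sequentially. False" by eventually_elim auto
      then show False by simp
    qed
    ultimately have \<Phi>z: "\<Phi> z = ereal L" by simp
    have "0 \<in> limiting_subdiff \<Phi> z"
    proof (rule limiting_subdiff_closed)
      show "(w \<circ> r) j \<in> limiting_subdiff \<Phi> ((x \<circ> r) j)" for j by (simp add: w)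
      show "(w \<circ> r) \<longlonglongrightarrow> 0" by (rule LIMSEQ_subseq_LIMSEQ[OF w0 r])
    qed (use z fr \<Phi>z in \<open>auto simp: o_def\<close>)
    with \<Phi>z show ?thesis by (auto simp: dom_limiting_subdiff_def)
  qed

  \<comment> \<open>The KL inequality at the window maximisers\<close>
  obtain F where F: "finite F" "\<And>\<eta> \<phi>. (\<eta>, \<phi>) \<in> F \<Longrightarrow> 0 < \<eta> \<and> \<phi> \<in> desingularizing \<eta>"
    and KLF: "\<forall>\<^sub>F k in sequentially. \<exists>(\<eta>, \<phi>)\<in>F. ereal L < \<Phi> (x k) \<and> \<Phi> (x k) < ereal L + \<eta> \<longrightarrow>
       1 \<le> ereal (deriv \<phi> (real_of_ereal (\<Phi> (x k) - ereal L))) * dist_origin (limiting_subdiff \<Phi> (x k))"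
    using KL_along_bounded_sequence[OF KL bdd, of "ereal L"] cluster by blast
  \<comment> \<open>Summing over all of \<open>F\<close> removes the dependence on which desingularizing function applies at \<open>k\<close>.\<close>
  define \<Delta> where "\<Delta> k = (\<Sum>p\<in>F. snd p (M k - L) - snd p (M (Suc k) - L))" for k
  have M0_lim: "(\<lambda>k. M k - L) \<longlonglongrightarrow> 0" using M_lim by (simp add: LIM_zero)
  have below: "\<forall>\<^sub>F k in sequentially. ereal (M k - L) < \<eta>" if "0 < \<eta>" for \<eta>
    using order_tendstoD(2)[OF _ that, of "\<lambda>k. ereal (M k - L)"] M0_lim by (simp add: zero_ereal_def)
  have "summable (\<lambda>k. \<phi> (M k - L) - \<phi> (M (Suc k) - L))" if "(\<eta>, \<phi>) \<in> F" for \<eta> \<phi>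
  proof -
    have "0 < \<eta>" and \<phi>: "\<phi> \<in> desingularizing \<eta>" using F(2)[OF that] by auto
    \<comment> \<open>Continuity of \<open>\<phi>\<close> at the endpoint \<open>0\<close> makes the
      telescoping series converge.\<close>
    have "(\<lambda>k. \<phi> (M k - L)) \<longlonglongrightarrow> \<phi> 0"
    proof (rule continuous_on_tendsto_compose[OF _ M0_lim])
      show "continuous_on {t. 0 \<le> t \<and> ereal t < \<eta>} \<phi>" using \<phi> by (simp add: desingularizing_def)
      show "\<forall>\<^sub>F k in sequentially. M k - L \<in> {t. 0 \<le> t \<and> ereal t < \<eta>}"
        using below[OF \<open>0 < \<eta>\<close>] by (rule eventually_mono) (simp add: L_le)
    qed (use \<open>0 < \<eta>\<close> in \<open>simp add: zero_ereal_def\<close>)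
    then show ?thesis by (rule telescope_summable')
  qed
  then have \<Delta>_summable: "summable \<Delta>" unfolding \<Delta>_def by (intro summable_sum) auto
  \<comment> \<open>Since \<open>l k \<ge> k - m\<close>, facts about late indices also hold at
    \<open>l k\<close>, and eventually \<open>l k - 1\<close> is a genuine predecessor.\<close>
  have "filterlim l at_top sequentially"
  proof (rule filterlim_at_top_mono)
    show "\<forall>\<^sub>F k in sequentially. k - m \<le> l k" using l by (intro always_eventually) auto
    show "filterlim (\<lambda>k. k - m) at_top sequentially" by (rule filterlim_minus_const_nat_at_top)
  qed
  then have "\<forall>\<^sub>F k in sequentially. 1 \<le> l k" and
    KLl: "\<forall>\<^sub>F k in sequentially. \<exists>(\<eta>, \<phi>)\<in>F. ereal L < \<Phi> (x (l k)) \<and> \<Phi> (x (l k)) < ereal L + \<eta> \<longrightarrow>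
       1 \<le> ereal (deriv \<phi> (real_of_ereal (\<Phi> (x (l k)) - ereal L))) * dist_origin (limiting_subdiff \<Phi> (x (l k)))"
    using eventually_compose_filterlim[OF KLF] eventually_compose_filterlim[OF eventually_ge_at_top[of 1]]
    by blast+
  moreover have "\<forall>\<^sub>F k in sequentially. \<forall>p\<in>F. ereal (M k - L) < fst p"
    using F below by (intro eventually_ball_finite) auto
  ultimately have key: "\<forall>\<^sub>F k in sequentially. 1 \<le> l k \<and> 0 \<le> \<Delta> k \<and>
      M k - M (Suc k) \<le> b * d (l k - 1) * \<Delta> k"
  proof eventually_elim
    case (elim k)
    let ?g = "\<lambda>p. snd p (M k - L) - snd p (M (Suc k) - L)"
    \<comment> \<open>Every pair in \<open>F\<close> contributes a nonnegative term, so the term of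
      the pair that applies at \<open>l k\<close> is at most \<open>\<Delta> k\<close>.\<close>
    have g0: "0 \<le> ?g p" if "p \<in> F" for p
      using desingularizing_mono[of "snd p" "fst p" "M (Suc k) - L" "M k - L"] F(2)[of "fst p" "snd p"]
        elim(3) that anti[of k] L_le[of "Suc k"] by auto
    then have "0 \<le> \<Delta> k" unfolding \<Delta>_def by (rule sum_nonneg)
    moreover have "M k - M (Suc k) \<le> b * d (l k - 1) * \<Delta> k"
    proof (cases "M k = L")
      \<comment> \<open>The KL inequality needs a value strictly above \<open>L\<close>. If
        \<open>M k = L\<close>, then \<open>M\<close> does not move at \<open>k\<close> and both
        sides vanish.\<close>
      case True
      then have "M (Suc k) = M k" using anti[of k] L_le[of "Suc k"] by simp
      then show ?thesis by (simp add: \<Delta>_def)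
    next
      case False
      then have "L < M k" using L_le[of k] by simp
      obtain \<eta> \<phi> where p: "(\<eta>, \<phi>) \<in> F" and imp: "ereal L < ereal (M k) \<and> ereal (M k) < ereal L + \<eta> \<longrightarrow>
         1 \<le> ereal (deriv \<phi> (M k - L)) * dist_origin (limiting_subdiff \<Phi> (x (l k)))"
        using elim(2) by (auto simp: \<Phi>x M_def)
      have lt: "ereal (M k - L) < \<eta>" using elim(3) p by force
      then have "ereal (M k) < ereal L + \<eta>" by (cases \<eta>) auto
      then have "1 \<le> ereal (deriv \<phi> (M k - L)) * dist_origin (limiting_subdiff \<Phi> (x (l k)))"
        using imp \<open>L < M k\<close> by simp
      moreover have "norm (w (l k)) \<le> b * d (l k - 1)"
        using w_le[of "l k - 1"] elim(1) by (simp add: d_def)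
      ultimately have "(M k - L) - (M (Suc k) - L) \<le> b * d (l k - 1) * (\<phi> (M k - L) - \<phi> (M (Suc k) - L))"
        using F(2)[OF p] lt \<open>L < M k\<close> anti[of k] L_le[of "Suc k"] w
        by (intro KL_decrease[where v = "w (l k)" and S = "limiting_subdiff \<Phi> (x (l k))"]) auto
      also have "\<dots> \<le> b * d (l k - 1) * \<Delta> k"
      proof (rule mult_left_mono)
        show "\<phi> (M k - L) - \<phi> (M (Suc k) - L) \<le> \<Delta> k"
          unfolding \<Delta>_def using member_le_sum[of "(\<eta>, \<phi>)" F ?g] p F(1) g0 by auto
      qed (use \<open>b > 0\<close> d0 in simp)
      finally show ?thesis by simp
    qed
    ultimately show ?case using elim(1) by blast
  qed

  \<comment> \<open>Summability from a quadratic decrease, up to a summable bound\<close>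
  have finish: "summable d"
    if c: "0 < c" and e: "summable e" "\<And>k. 0 \<le> e k"
      and ev: "\<forall>\<^sub>F k in sequentially. c * (d k)\<^sup>2 \<le> M k - M (Suc k) \<or> d k \<le> e k" for c e
  proof -
    \<comment> \<open>With \<open>m + 1\<close> terms in the recursion below, the contraction factor
      is \<open>1 / 2\<close>.\<close>
    define \<epsilon> where "\<epsilon> = 1 / (2 * real (Suc m))"
    define C where "C = b / (4 * c * \<epsilon>)"
    have \<epsilon>: "0 < \<epsilon>" "\<epsilon> * real (Suc m) < 1" by (simp_all add: \<epsilon>_def field_simps)
    have "0 \<le> C" using c \<epsilon> \<open>b > 0\<close> by (simp add: C_def)
    show ?thesis
    proof (rule summable_of_contractive_recursion[OF d0 _ _ \<epsilon>(2)])
      show "summable (\<lambda>k. C * \<Delta> k + e k)"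
        by (intro summable_add summable_mult \<Delta>_summable e)
      show "\<forall>\<^sub>F k in sequentially. d k \<le> \<epsilon> * (\<Sum>i=1..Suc m. d (k - i)) + (C * \<Delta> k + e k)"
        using key ev
      proof eventually_elim
        case (elim k)
        have le: "d (l k - 1) \<le> (\<Sum>i=1..Suc m. d (k - i))"
        proof -
          \<comment> \<open>As \<open>l k\<close> lies at most \<open>m\<close> behind
            \<open>k\<close>, its predecessor lies between \<open>1\<close> and \<open>m + 1\<close>
            behind. Bounding by the sum over all these offsets removes the dependence on
            \<open>l\<close>.\<close>
          let ?i = "Suc (k - l k)"
          have "?i \<in> {1..Suc m}" "k - ?i = l k - 1" using l[of k] elim(1) by auto
          then show ?thesis using member_le_sum[of ?i "{1..Suc m}" "\<lambda>i. d (k - i)"] d0 by simp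
        qed
        have "d k \<le> \<epsilon> * d (l k - 1) + C * \<Delta> k \<or> d k \<le> e k"
          using elim square_le_product_imp[of c "d k" b "d (l k - 1)" "\<Delta> k" \<epsilon>] c \<epsilon>(1) d0 \<open>b > 0\<close>
          unfolding C_def by fastforce
        moreover have "\<epsilon> * d (l k - 1) \<le> \<epsilon> * (\<Sum>i=1..Suc m. d (k - i))"
          using le \<epsilon>(1) by (intro mult_left_mono) auto
        moreover have "0 \<le> \<epsilon> * d (l k - 1)" "0 \<le> C * \<Delta> k" using \<epsilon>(1) d0 \<open>0 \<le> C\<close> elim(1) by auto
        ultimately show ?case using e(2)[of k] by linarith
      qed
    qed (use \<epsilon> in simp)
  qed

  \<comment> \<open>The two cases for the lower limit of the quotients\<close>
  have K1: "k \<in> K\<^sub>1 \<Phi> x m a \<longleftrightarrow> a / 2 * (d k)\<^sup>2 \<le> M (Suc k) - f (Suc k)" for k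
    by (simp add: K\<^sub>1_def \<Phi>x M_def l_def d_def)
  \<comment> \<open>Outside \<open>K\<^sub>1\<close>, passing from \<open>f (Suc k)\<close> to
    \<open>M (Suc k)\<close> costs less than half of the decrease in (H1).\<close>
  have K2: "a / 2 * (d k)\<^sup>2 \<le> M k - M (Suc k)" if "k \<notin> K\<^sub>1 \<Phi> x m a" for k
    using that descent[of k] unfolding K1 by linarith
  show ?thesis
  proof (cases "liminf_along (K\<^sub>1 \<Phi> x m a) (decrease_quotient \<Phi> x m) = 0")
    case True
    \<comment> \<open>Extension by zero turns the sum over \<open>K\<^sub>1\<close> into an ordinary
      series.\<close>
    define s where "s k = (if k \<in> K\<^sub>1 \<Phi> x m a then sqrt (M (Suc k) - f (Suc k)) else 0)" for k
    have "(\<lambda>k. sqrt (real_of_ereal (\<Phi> (x (ell \<Phi> x m (Suc k))) - \<Phi> (x (Suc k)))))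
        summable_on K\<^sub>1 \<Phi> x m a" by (rule K1_sum[OF True])
    then have "s summable_on UNIV"
      by (rule iffD1[OF summable_on_cong_neutral, rotated 3])
        (auto simp: s_def \<Phi>x M_def l_def)
    then have "summable s" by (rule summable_on_imp_summable)
    have s0: "0 \<le> s k" for k using fM by (simp add: s_def)
    have K1_le: "d k \<le> sqrt (2 / a) * s k" if "k \<in> K\<^sub>1 \<Phi> x m a" for k
    proof -
      have "(d k)\<^sup>2 \<le> 2 / a * (M (Suc k) - f (Suc k))"
        using that \<open>a > 0\<close> unfolding K1 by (simp add: field_simps)
      then show ?thesis using that by (simp add: s_def real_le_rsqrt flip: real_sqrt_mult)
    qed
    have "summable d"
    proof (intro finish[of "a / 2" "\<lambda>k. sqrt (2 / a) * s k"] always_eventually allI)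
      show "a / 2 * (d k)\<^sup>2 \<le> M k - M (Suc k) \<or> d k \<le> sqrt (2 / a) * s k" for k
        using K1_le K2 by blast
    qed (use \<open>a > 0\<close> s0 \<open>summable s\<close> in \<open>auto intro: summable_mult\<close>)
    then show ?thesis by (simp add: d_def[abs_def])
  next
    case False
    have q: "decrease_quotient \<Phi> x m k = (if d k = 0 then \<infinity> else ereal ((M k - M (Suc k)) / (d k)\<^sup>2))" for k
      by (simp add: decrease_quotient_def \<Phi>x M_def l_def d_def)
    \<comment> \<open>The quotients are nonnegative because \<open>M\<close> is nonincreasing, so a
      nonzero lower limit is positive, possibly infinite, as for finite
      \<open>K\<^sub>1\<close>.\<close>
    have "0 \<le> liminf_along (K\<^sub>1 \<Phi> x m a) (decrease_quotient \<Phi> x m)"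
      unfolding liminf_along_def using anti by (intro Liminf_bounded always_eventually) (simp add: q)
    with False have "0 < liminf_along (K\<^sub>1 \<Phi> x m a) (decrease_quotient \<Phi> x m)" by simp
    then obtain c where c: "ereal 0 < ereal c" "ereal c < liminf_along (K\<^sub>1 \<Phi> x m a) (decrease_quotient \<Phi> x m)"
      using ereal_dense2 unfolding zero_ereal_def by blast
    then have "\<forall>\<^sub>F k in inf sequentially (principal (K\<^sub>1 \<Phi> x m a)). ereal c < decrease_quotient \<Phi> x m k"
      unfolding liminf_along_def using less_LiminfD by blast
    then have "\<forall>\<^sub>F k in sequentially. k \<in> K\<^sub>1 \<Phi> x m a \<longrightarrow> ereal c < decrease_quotient \<Phi> x m k"
      by (simp add: eventually_inf_principal)
    \<comment> \<open>The minimum gives one constant valid both on \<open>K\<^sub>1\<close> (through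
      \<open>c\<close>) and off it (through \<open>K2\<close>).\<close>
    then have "\<forall>\<^sub>F k in sequentially. min c (a / 2) * (d k)\<^sup>2 \<le> M k - M (Suc k)"
    proof eventually_elim
      case (elim k)
      show ?case
      proof (cases "k \<in> K\<^sub>1 \<Phi> x m a")
        case True
        \<comment> \<open>For \<open>d k = 0\<close> the quotient is infinite by convention and the
          claim is monotonicity of \<open>M\<close>.\<close>
        then have "c * (d k)\<^sup>2 \<le> M k - M (Suc k)"
          using elim anti[of k] by (auto simp: q pos_less_divide_eq split: if_splits)
        moreover have "min c (a / 2) * (d k)\<^sup>2 \<le> c * (d k)\<^sup>2" by (intro mult_right_mono) auto
        ultimately show ?thesis by linarith
      next
        case False
        moreover have "min c (a / 2) * (d k)\<^sup>2 \<le> a / 2 * (d k)\<^sup>2" by (intro mult_right_mono) auto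
        ultimately show ?thesis using K2[of k] by linarith
      qed
    qed
    then have "summable d"
      using c(1) \<open>a > 0\<close> by (intro finish[of "min c (a / 2)" "\<lambda>_. 0"]) (auto elim: eventually_mono)
    then show ?thesis by (simp add: d_def[abs_def])
  qed
qed

end
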